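(* Let $P$ be a level poset with underlying digraph on the vertex set $V$, and let $x,y\in V$. Then the $\mathbf{a}\mathbf{b}$-series $\Psi_{x,y}$ of $P$ is a rational generating function in the non-commutative variables $\mathbf{a}$ and $\mathbf{b}$.
   Context: Level poset: let $M$ be a $0/1$ square matrix with rows and columns indexed by a finite nonempty set $V$. The level poset of $M$ is the poset on $V\times\mathbb{Z}$ with $(u,i)<(v,j)$ if and only if $i<j$ and $(M^{j-i})_{u,v}>0$; the second coordinate is its rank function. $\mathbf{a}\mathbf{b}$-index: for a finite graded poset $Q$ of rank $m+1$ with minimum $\hat0$, maximum $\hat1$ and rank function $\rho$, and a chain $c=\{\hat0=x_0<x_1<\cdots<x_{k+1}=\hat1\}$, put $$\operatorname{wt}(c)=(\mathbf{a}-\mathbf{b})^{\rho(x_0,x_1)-1}\cdot\mathbf{b}\cdot(\mathbf{a}-\mathbf{b})^{\rho(x_1,x_2)-1}\cdot\mathbf{b}\cdots\mathbf{b}\cdot(\mathbf{a}-\mathbf{b})^{\rho(x_k,x_{k+1})-1},$$ where $\rho(x,y)=\rho(y)-\rho(x)$ and $\mathbf{a},\mathbf{b}$ are non-commuting variables of degree one. Then $\Psi(Q)=\sum_c\operatorname{wt}(c)$, summed over all chains $c$ containing $\hat0$ and $\hat1$; it is homogeneous of degree $m$. $\mathbf{a}\mathbf{b}$-series: $\Psi_{x,y}=\sum_{m\ge0}\Psi([(x,0),(y,m+1)])\in\mathbb{R}\langle\langle\mathbf{a},\mathbf{b}\rangle\rangle$, where $\Psi([(x,0),(y,m+1)])$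 is taken to be $0$ if $(x,0)\not\le(y,m+1)$. A non-commutative formal power series is rational if it belongs to the smallest set of series containing all non-commutative polynomials and closed under sums, products, and inverses of series with nonzero constant term. *)

theory Defs
  imports "HOL-Analysis.Analysis"
begin

text \<open>
  A series over the alphabet \<open>'x\<close> with coefficients in \<open>'c\<close> is an arbitrary function on
  the words \<open>'x list\<close>; the empty word carries the constant term.
\<close>

typedef ('x, 'c) nc_fps = "UNIV :: ('x list \<Rightarrow> 'c) set"
  morphisms nc_nth Abs_nc_fps
  by simp

setup_lifting type_definition_nc_fps

lemma nc_fps_eqI: "(\<And>w. nc_nth f w = nc_nth g w) \<Longrightarrow> f = g"
  by (simp add: nc_nth_inject [symmetric] fun_eq_iff)

definition word_conv :: "('x list \<Rightarrow> 'c::ring_1) \<Rightarrow> ('x list \<Rightarrow> 'c) \<Rightarrow> 'x list \<Rightarrow> 'c" where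
  "word_conv f g w = (\<Sum>i\<le>length w. f (take i w) * g (drop i w))"

lemma word_conv_Nil: "word_conv f g [] = f [] * g []"
  by (simp add: word_conv_def)

lemma word_conv_Cons:
  "word_conv f g (a # w) = f [] * g (a # w) + word_conv (\<lambda>u. f (a # u)) g w"
  by (simp add: word_conv_def sum.atMost_Suc_shift del: sum.atMost_Suc)

lemma word_conv_add_left: "word_conv (\<lambda>u. f u + g u) h w = word_conv f h w + word_conv g h w"
  by (simp add: word_conv_def ring_distribs sum.distrib)

lemma word_conv_add_right: "word_conv f (\<lambda>u. g u + h u) w = word_conv f g w + word_conv f h w"
  by (simp add: word_conv_def ring_distribs sum.distrib)

lemma word_conv_scale_left: "word_conv (\<lambda>u. c * f u) g w = c * word_conv f g w"
  by (simp add: word_conv_def sum_distrib_left mult.assoc)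

lemma word_conv_assoc: "word_conv (word_conv f g) h w = word_conv f (word_conv g h) w"
proof (induction w arbitrary: f)
  case Nil
  then show ?case by (simp add: word_conv_Nil mult.assoc)
next
  case (Cons a w)
  then show ?case
    by (simp add: word_conv_Cons word_conv_Nil word_conv_add_left word_conv_scale_left
        ring_distribs mult.assoc)
qed

lemma word_conv_one_left: "word_conv (\<lambda>u. if u = [] then 1 else 0) f w = f w"
proof (cases w)
  case Nil
  then show ?thesis by (simp add: word_conv_Nil)
next
  case (Cons a v)
  then show ?thesis by (simp add: word_conv_Cons) (simp add: word_conv_def)
qed

lemma word_conv_one_right: "word_conv f (\<lambda>u. if u = [] then 1 else 0) w = f w"
  by (induction w arbitrary: f) (simp_all add: word_conv_Nil word_conv_Cons)

instantiation nc_fps :: (type, ring_1) ring_1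
begin

lift_definition zero_nc_fps :: "('a, 'b) nc_fps" is "\<lambda>_. 0" .
lift_definition one_nc_fps :: "('a, 'b) nc_fps" is "\<lambda>w. if w = [] then 1 else 0" .
lift_definition plus_nc_fps :: "('a, 'b) nc_fps \<Rightarrow> ('a, 'b) nc_fps \<Rightarrow> ('a, 'b) nc_fps"
  is "\<lambda>f g w. f w + g w" .
lift_definition minus_nc_fps :: "('a, 'b) nc_fps \<Rightarrow> ('a, 'b) nc_fps \<Rightarrow> ('a, 'b) nc_fps"
  is "\<lambda>f g w. f w - g w" .
lift_definition uminus_nc_fps :: "('a, 'b) nc_fps \<Rightarrow> ('a, 'b) nc_fps"
  is "\<lambda>f w. - f w" .
lift_definition times_nc_fps :: "('a, 'b) nc_fps \<Rightarrow> ('a, 'b) nc_fps \<Rightarrow> ('a, 'b) nc_fps"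
  is word_conv .

instance
proof
  show "(0 :: ('a, 'b) nc_fps) \<noteq> 1"
    by transfer (metis zero_neq_one)
qed (transfer; simp add: fun_eq_iff word_conv_assoc word_conv_one_left word_conv_one_right
      word_conv_add_left word_conv_add_right algebra_simps)+

end

lift_definition nc_var :: "'x \<Rightarrow> ('x, 'c::ring_1) nc_fps"
  is "\<lambda>a w. if w = [a] then 1 else 0" .

definition nc_polynomial :: "('x, 'c::ring_1) nc_fps \<Rightarrow> bool" where
  "nc_polynomial f \<longleftrightarrow> finite {w. nc_nth f w \<noteq> 0}"

text \<open>
  The two equations \<open>f * g = 1\<close> and \<open>g * f = 1\<close> say that \<open>g\<close> is the (unique)
  two-sided inverse of \<open>f\<close>.
\<close>

inductive nc_rational :: "('x, 'c::field) nc_fps \<Rightarrow> bool" where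
  polynomial: "nc_polynomial f \<Longrightarrow> nc_rational f"
| add: "nc_rational f \<Longrightarrow> nc_rational g \<Longrightarrow> nc_rational (f + g)"
| mult: "nc_rational f \<Longrightarrow> nc_rational g \<Longrightarrow> nc_rational (f * g)"
| inverse: "nc_rational f \<Longrightarrow> nc_nth f [] \<noteq> 0 \<Longrightarrow> f * g = 1 \<Longrightarrow> g * f = 1 \<Longrightarrow> nc_rational g"

text \<open>
  Formal sum of a family of series, computed coefficientwise. It is meaningful for locally finite
  families, in which every word has a nonzero coefficient in only finitely many members.
\<close>

definition nc_formal_sum :: "(nat \<Rightarrow> ('x, 'c::ring_1) nc_fps) \<Rightarrow> ('x, 'c) nc_fps" where
  "nc_formal_sum F = Abs_nc_fps (\<lambda>w. \<Sum>m | nc_nth (F m) w \<noteq> 0. nc_nth (F m) w)"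

definition nc_homogeneous :: "nat \<Rightarrow> ('x, 'c::ring_1) nc_fps \<Rightarrow> bool" where
  "nc_homogeneous n f \<longleftrightarrow> (\<forall>w. nc_nth f w \<noteq> 0 \<longrightarrow> length w = n)"

lemma nc_homogeneous_zero: "nc_homogeneous n 0"
  unfolding nc_homogeneous_def by transfer simp

lemma nc_homogeneous_one: "nc_homogeneous 0 1"
  unfolding nc_homogeneous_def by transfer simp

lemma nc_homogeneous_var: "nc_homogeneous 1 (nc_var a)"
  unfolding nc_homogeneous_def by transfer simp

lemma nc_homogeneous_add: "nc_homogeneous n f \<Longrightarrow> nc_homogeneous n g \<Longrightarrow> nc_homogeneous n (f + g)"
  unfolding nc_homogeneous_def by transfer force

lemma nc_homogeneous_diff: "nc_homogeneous n f \<Longrightarrow> nc_homogeneous n g \<Longrightarrow> nc_homogeneous n (f - g)"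
  unfolding nc_homogeneous_def by transfer force

lemma nc_homogeneous_mult:
  assumes "nc_homogeneous m f" "nc_homogeneous n g"
  shows "nc_homogeneous (m + n) (f * g)"
  unfolding nc_homogeneous_def
proof (intro allI impI)
  fix w assume "nc_nth (f * g) w \<noteq> 0"
  then have "(\<Sum>i\<le>length w. nc_nth f (take i w) * nc_nth g (drop i w)) \<noteq> 0"
    by (simp add: times_nc_fps.rep_eq word_conv_def)
  then obtain i where "i \<le> length w" "nc_nth f (take i w) * nc_nth g (drop i w) \<noteq> 0"
    by (metis (mono_tags, lifting) atMost_iff sum.neutral)
  then have "nc_nth f (take i w) \<noteq> 0" "nc_nth g (drop i w) \<noteq> 0"
    by auto
  with assms have "length (take i w) = m" "length (drop i w) = n"
    by (auto simp: nc_homogeneous_def)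
  then show "length w = m + n"
    by (metis append_take_drop_id length_append)
qed

lemma nc_homogeneous_power: "nc_homogeneous 1 f \<Longrightarrow> nc_homogeneous n (f ^ n)"
  by (induction n) (use nc_homogeneous_mult [of 1 f] in \<open>auto simp: nc_homogeneous_one\<close>)

lemma nc_homogeneous_sum: "(\<And>i. i \<in> I \<Longrightarrow> nc_homogeneous n (f i)) \<Longrightarrow> nc_homogeneous n (sum f I)"
  by (induction I rule: infinite_finite_induct) (auto simp: nc_homogeneous_zero nc_homogeneous_add)

datatype letter = LA | LB

type_synonym ab_series = "(letter, real) nc_fps"

definition var_a :: ab_series where "var_a = nc_var LA"

definition var_b :: ab_series where "var_b = nc_var LB"

text \<open>
  The chain \<open>x\<^sub>0 < x\<^sub>1 < \<dots> < x\<^sub>k\<^sub>+\<^sub>1\<close> is given as the list of its elements in increasing order.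
  Consecutive ranks differ by at least 1, so \<open>nat\<close> does not truncate. The value on the empty list
  is never used.
\<close>

fun wt :: "('p \<Rightarrow> int) \<Rightarrow> 'p list \<Rightarrow> ab_series" where
  "wt \<rho> (x # y # z # zs) = (var_a - var_b) ^ nat (\<rho> y - \<rho> x - 1) * var_b * wt \<rho> (y # z # zs)"
| "wt \<rho> [x, y] = (var_a - var_b) ^ nat (\<rho> y - \<rho> x - 1)"
| "wt \<rho> _ = 1"

text \<open>
  The poset has carrier \<open>Q\<close>, strict order \<open>lt\<close>, rank function \<open>\<rho>\<close>, minimum \<open>p\<close> and
  maximum \<open>q\<close> with \<open>p \<noteq> q\<close>. Strictly increasing lists correspond bijectively to finite chains.
\<close>

definition bounded_chains :: "'p set \<Rightarrow> ('p \<Rightarrow> 'p \<Rightarrow> bool) \<Rightarrow> 'p \<Rightarrow> 'p \<Rightarrow> 'p list set" where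
  "bounded_chains Q lt p q =
     {c. c \<noteq> [] \<and> set c \<subseteq> Q \<and> sorted_wrt lt c \<and> hd c = p \<and> last c = q}"

definition ab_index ::
    "'p set \<Rightarrow> ('p \<Rightarrow> 'p \<Rightarrow> bool) \<Rightarrow> ('p \<Rightarrow> int) \<Rightarrow> 'p \<Rightarrow> 'p \<Rightarrow> ab_series" where
  "ab_index Q lt \<rho> p q = (\<Sum>c\<in>bounded_chains Q lt p q. wt \<rho> c)"

lemma finite_bounded_chains:
  assumes "finite Q" "\<And>x. \<not> lt x x"
  shows "finite (bounded_chains Q lt p q)"
proof -
  have "distinct c" if "sorted_wrt lt c" for c
    using that assms(2) by (induction c) auto
  then have "bounded_chains Q lt p q \<subseteq> {c. set c \<subseteq> Q \<and> distinct c}"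
    by (auto simp: bounded_chains_def)
  then show ?thesis
    by (rule finite_subset) (rule finite_subset_distinct [OF assms(1)])
qed

lemma ab_homogeneous: "nc_homogeneous 1 (var_a - var_b)" "nc_homogeneous 1 var_b"
  unfolding var_a_def var_b_def by (intro nc_homogeneous_diff nc_homogeneous_var)+

lemma wt_homogeneous:
  assumes "sorted_wrt lt c" "2 \<le> length c" "\<And>x y. lt x y \<Longrightarrow> \<rho> x < \<rho> y"
  shows "nc_homogeneous (nat (\<rho> (last c) - \<rho> (hd c) - 1)) (wt \<rho> c) \<and> \<rho> (hd c) < \<rho> (last c)"
  using assms
proof (induction \<rho> c rule: wt.induct)
  case (1 \<rho>' x y z zs)
  let ?l = "last (y # z # zs)" and ?r = "nat (\<rho>' y - \<rho>' x - 1)"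
  have IH: "nc_homogeneous (nat (\<rho>' ?l - \<rho>' y - 1)) (wt \<rho>' (y # z # zs))" "\<rho>' y < \<rho>' ?l"
    using 1 by force+
  have xy: "\<rho>' x < \<rho>' y"
    using 1 by auto
  have "nc_homogeneous (?r + 1 + nat (\<rho>' ?l - \<rho>' y - 1)) (wt \<rho>' (x # y # z # zs))"
    unfolding wt.simps
    by (intro nc_homogeneous_mult nc_homogeneous_power ab_homogeneous IH)
  moreover have "?r + 1 + nat (\<rho>' ?l - \<rho>' y - 1) = nat (\<rho>' ?l - \<rho>' x - 1)"
    using xy IH(2) by simp
  ultimately show ?case
    using xy IH(2) by simp
next
  case (2 \<rho>' x y)
  then show ?case
    using nc_homogeneous_power [OF ab_homogeneous(1)] by simp
qed simp_all

text \<open>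
  The power \<open>^\<close> on the type of matrices is entrywise, so the matrix power is iterated
  multiplication with \<open>**\<close>.
\<close>

definition matrix_power :: "'a::semiring_1 ^ 'n ^ 'n \<Rightarrow> nat \<Rightarrow> 'a ^ 'n ^ 'n" where
  "matrix_power M n = (((**) M) ^^ n) (mat 1)"

text \<open>
  Natural number entries keep all matrix powers nonnegative, so that positivity of an entry of
  \<open>M ^ n\<close> means existence of a walk of length \<open>n\<close> in the digraph with adjacency matrix \<open>M\<close>,
  whose vertex set is the (finite, nonempty) index type.
\<close>

definition zero_one_matrix :: "nat ^ 'n ^ 'm \<Rightarrow> bool" where
  "zero_one_matrix M \<longleftrightarrow> (\<forall>u v. M $ u $ v \<in> {0, 1})"

definition level_less :: "nat ^ 'v ^ 'v \<Rightarrow> 'v::finite \<times> int \<Rightarrow> 'v \<times> int \<Rightarrow> bool" where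
  "level_less M p q \<longleftrightarrow>
     snd p < snd q \<and> matrix_power M (nat (snd q - snd p)) $ fst p $ fst q > 0"

definition level_le :: "nat ^ 'v ^ 'v \<Rightarrow> 'v::finite \<times> int \<Rightarrow> 'v \<times> int \<Rightarrow> bool" where
  "level_le M p q \<longleftrightarrow> level_less M p q \<or> p = q"

definition level_interval :: "nat ^ 'v ^ 'v \<Rightarrow> 'v::finite \<times> int \<Rightarrow> 'v \<times> int \<Rightarrow> ('v \<times> int) set" where
  "level_interval M p q = {z. level_le M p z \<and> level_le M z q}"

definition level_ab_index :: "nat ^ 'v ^ 'v \<Rightarrow> 'v::finite \<times> int \<Rightarrow> 'v \<times> int \<Rightarrow> ab_series" where
  "level_ab_index M p q =
     (if level_le M p q then ab_index (level_interval M p q) (level_less M) snd p q else 0)"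

definition level_ab_series :: "nat ^ 'v ^ 'v \<Rightarrow> 'v::finite \<Rightarrow> 'v \<Rightarrow> ab_series" where
  "level_ab_series M x y = nc_formal_sum (\<lambda>m. level_ab_index M (x, 0) (y, int m + 1))"

lemma matrix_power_add: "matrix_power M (m + n) = matrix_power M m ** matrix_power M n"
  by (induction m) (simp_all add: matrix_power_def matrix_mul_assoc)

lemma matrix_power_add_pos_iff:
  fixes M :: "nat ^ 'v::finite ^ 'v"
  shows "matrix_power M (m + n) $ u $ v > 0 \<longleftrightarrow>
    (\<exists>w. matrix_power M m $ u $ w > 0 \<and> matrix_power M n $ w $ v > 0)"
proof -
  have "matrix_power M (m + n) $ u $ v =
      (\<Sum>w\<in>UNIV. matrix_power M m $ u $ w * matrix_power M n $ w $ v)"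
    by (simp add: matrix_power_add matrix_matrix_mult_def)
  then show ?thesis
    by (simp only: zero_less_iff_neq_zero sum_eq_0_iff finite_class.finite_UNIV mult_eq_0_iff
        ball_UNIV not_all de_Morgan_disj)
qed

lemma level_ordering: "ordering (level_le M) (level_less M)"
proof -
  have trans: "level_less M p r" if "level_less M p q" "level_less M q r" for p q r
  proof -
    have "nat (snd r - snd p) = nat (snd q - snd p) + nat (snd r - snd q)"
      using that by (simp add: level_less_def nat_add_distrib [symmetric])
    then have "matrix_power M (nat (snd r - snd p)) $ fst p $ fst r > 0"
      using that unfolding level_less_def by (auto simp only: matrix_power_add_pos_iff)
    then show ?thesis
      using that by (simp add: level_less_def)
  qed
  have irr: "\<not> level_less M p p" for p
    by (simp add: level_less_def)
  show ?thesis
  proof (rule ordering_strictI)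
    show "level_le M p q \<longleftrightarrow> level_less M p q \<or> p = q" for p q
      by (simp add: level_le_def)
    show "\<not> level_less M q p" if "level_less M p q" for p q
      using that by (simp add: level_less_def)
  qed (use irr trans in \<open>assumption | blast\<close>)+
qed

lemma level_graded:
  assumes "level_less M p q" "snd p < i" "i < snd q"
  shows "\<exists>z. snd z = i \<and> level_less M p z \<and> level_less M z q"
proof -
  have "nat (snd q - snd p) = nat (i - snd p) + nat (snd q - i)"
    using assms by (simp add: nat_add_distrib [symmetric])
  then obtain w where "matrix_power M (nat (i - snd p)) $ fst p $ w > 0"
      "matrix_power M (nat (snd q - i)) $ w $ fst q > 0"
    using assms(1) unfolding level_less_def by (auto simp only: matrix_power_add_pos_iff)
  then show ?thesis
    using assms by (intro exI [of _ "(w, i)"]) (simp add: level_less_def)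
qed

lemma finite_level_interval: "finite (level_interval M p q)"
proof -
  have "level_interval M p q \<subseteq> UNIV \<times> {snd p..snd q}"
    by (auto simp: level_interval_def level_le_def level_less_def)
  then show ?thesis
    by (rule finite_subset) simp
qed

text \<open>
  This makes the family summed in \<open>level_ab_series\<close> locally finite: a word of length \<open>n\<close>
  receives a contribution from the summand \<open>m = n\<close> only.
\<close>

lemma level_ab_index_homogeneous: "nc_homogeneous m (level_ab_index M (x, 0) (y, int m + 1))"
proof -
  have "nc_homogeneous m (wt snd c)"
    if "c \<in> bounded_chains Q (level_less M) (x, 0) (y, int m + 1)" for c Q
  proof -
    have c: "c \<noteq> []" "sorted_wrt (level_less M) c" "hd c = (x, 0)" "last c = (y, int m + 1)"
      using that by (auto simp: bounded_chains_def)
    have "2 \<le> length c"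
    proof (rule ccontr)
      assume "\<not> 2 \<le> length c"
      then have "length c = 1"
        using c(1) by (auto simp: not_le less_2_cases_iff)
      then have "hd c = last c"
        by (auto simp: length_Suc_conv)
      then show False
        using c by simp
    qed
    then show ?thesis
      using wt_homogeneous [of "level_less M" c snd] c by (simp add: level_less_def)
  qed
  then show ?thesis
    by (auto simp: level_ab_index_def ab_index_def nc_homogeneous_zero intro!: nc_homogeneous_sum)
qed

end

theory Submission
  imports Defs
begin

text \<open>
  Write \<open>t = a - b\<close>. For a set \<open>S\<close> of vertices let \<open>X S\<close> be the generating function of the chains
  that start at the set \<open>S\<close>, regarded as a single bottom element, and end at the vertex \<open>y\<close>.
  Moving up one level without choosing a chain element replaces \<open>S\<close> by its set \<open>S'\<close> of successors
  and contributes \<open>t\<close>; choosing the element \<open>z\<close> of \<open>S'\<close> contributes \<open>b\<close> and restarts at \<open>{z}\<close>. Hence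
  \<open>X S = [y \<in> S'] + t * X S' + (\<Sum>z\<in>S'. b * X {z})\<close>, a finite linear system whose coefficients are
  polynomials without constant term, and Gaussian elimination shows that its solution is rational.
  Using sets of vertices as unknowns makes the eventual periodicity of the Boolean powers of \<open>M\<close>
  unnecessary.
\<close>

section \<open>Linear systems of non-commutative series\<close>

lemma nc_nth_simps [simp]:
  "nc_nth 0 w = 0"
  "nc_nth 1 w = (if w = [] then 1 else 0)"
  "nc_nth (f + g) w = nc_nth f w + nc_nth g w"
  "nc_nth (f - g) w = nc_nth f w - nc_nth g w"
  "nc_nth (- f) w = - nc_nth f w"
  by (transfer; simp)+

lemma nc_nth_mult: "nc_nth (f * g) w = (\<Sum>i\<le>length w. nc_nth f (take i w) * nc_nth g (drop i w))"
  by (simp add: times_nc_fps.rep_eq word_conv_def)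

lemma nc_nth_mult_Nil [simp]: "nc_nth (f * g) [] = nc_nth f [] * nc_nth g []"
  by (simp add: nc_nth_mult)

lemma nc_nth_sum [simp]: "nc_nth (sum f I) w = (\<Sum>i\<in>I. nc_nth (f i) w)"
  by (induction I rule: infinite_finite_induct) auto

text \<open>The coefficient at \<open>w\<close> involves only words no longer than \<open>w\<close>,
  so an infinite series may be replaced by a partial sum that agrees with it there.\<close>

lemma nc_nth_mult_cong_right:
  assumes "\<And>v. length v \<le> length w \<Longrightarrow> nc_nth g v = nc_nth h v"
  shows "nc_nth (f * g) w = nc_nth (f * h) w"
  unfolding nc_nth_mult by (intro sum.cong refl) (simp add: assms)

lemma nc_nth_mult_cong_left:
  assumes "\<And>v. length v \<le> length w \<Longrightarrow> nc_nth g v = nc_nth h v"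
  shows "nc_nth (g * f) w = nc_nth (h * f) w"
  unfolding nc_nth_mult by (intro sum.cong refl) (simp add: assms)

lemma nc_nth_power_eq_0:
  assumes "nc_nth h [] = 0" "length w < n"
  shows "nc_nth (h ^ n) w = 0"
  using assms(2)
proof (induction n arbitrary: w)
  case (Suc n)
  have "nc_nth h (take i w) * nc_nth (h ^ n) (drop i w) = 0" if "i \<le> length w" for i
    using Suc assms(1) that by (cases i) auto
  then show ?case
    by (simp add: nc_nth_mult)
qed simp

text \<open>The inverse is the geometric series in \<open>h\<close>. Both one-sided identities are
  recorded because \<open>nc_rational.inverse\<close> asks for both.\<close>

lemma nc_geometric_inverse:
  fixes h :: "('x, 'c::ring_1) nc_fps"
  assumes h0: "nc_nth h [] = 0"
  obtains g where "(1 - h) * g = 1" "g * (1 - h) = 1"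
proof
  define G where "G N = (\<Sum>n<N. h ^ n)" for N
  \<comment> \<open>The powers \<open>h ^ n\<close> with \<open>n > length w\<close> vanish at
    \<open>w\<close>, so the first \<open>Suc (length w)\<close> powers already give the final
    coefficient.\<close>
  define g where "g = Abs_nc_fps (\<lambda>w. nc_nth (G (Suc (length w))) w)"
  have G_Suc: "G (Suc N) = G N + h ^ N" for N
    by (simp add: G_def)
  have G_left: "(1 - h) * G N = 1 - h ^ N" for N
  proof (induction N)
    case (Suc N)
    then show ?case
      by (simp add: G_Suc distrib_left) (simp add: left_diff_distrib)
  qed (simp add: G_def)
  have G_right: "G N * (1 - h) = 1 - h ^ N" for N
  proof (induction N)
    case (Suc N)
    then show ?case
      by (simp add: G_Suc distrib_right) (simp add: right_diff_distrib power_commutes)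
  qed (simp add: G_def)
  have stable: "nc_nth (G N) w = nc_nth (G (Suc (length w))) w" if "length w < N" for N w
    using that
  proof (induction N)
    case (Suc N)
    then show ?case
      by (cases "length w = N") (auto simp: G_def nc_nth_power_eq_0 [OF h0])
  qed simp
  have g: "nc_nth g v = nc_nth (G N) v" if "length v < N" for v N
    using stable [OF that] by (simp add: g_def Abs_nc_fps_inverse)
  have pow: "nc_nth (1 - h ^ Suc (length w)) w = nc_nth 1 w" for w
    by (simp add: nc_nth_power_eq_0 [OF h0] del: power_Suc)
  show "(1 - h) * g = 1"
  proof (rule nc_fps_eqI)
    fix w
    have "nc_nth ((1 - h) * g) w = nc_nth ((1 - h) * G (Suc (length w))) w"
      by (rule nc_nth_mult_cong_right) (simp add: g)
    then show "nc_nth ((1 - h) * g) w = nc_nth 1 w"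
      by (simp only: G_left pow)
  qed
  show "g * (1 - h) = 1"
  proof (rule nc_fps_eqI)
    fix w
    have "nc_nth (g * (1 - h)) w = nc_nth (G (Suc (length w)) * (1 - h)) w"
      by (rule nc_nth_mult_cong_left) (simp add: g)
    then show "nc_nth (g * (1 - h)) w = nc_nth 1 w"
      by (simp only: G_right pow)
  qed
qed

section \<open>Closure properties of rational series and Gaussian elimination\<close>

lemma nc_rational_0: "nc_rational 0"
  by (rule nc_rational.polynomial) (simp add: nc_polynomial_def)

lemma nc_rational_1: "nc_rational 1"
  by (rule nc_rational.polynomial) (simp add: nc_polynomial_def)

lemma nc_rational_var: "nc_rational (nc_var a)"
  by (rule nc_rational.polynomial) (simp add: nc_polynomial_def nc_var.rep_eq)

lemma nc_rational_uminus:
  fixes f :: "('x, 'c::field) nc_fps"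
  assumes "nc_rational f"
  shows "nc_rational (- f)"
proof -
  have "nc_rational (- 1 :: ('x, 'c) nc_fps)"
    by (rule nc_rational.polynomial) (simp add: nc_polynomial_def)
  from nc_rational.mult [OF this assms] show ?thesis
    by simp
qed

lemma nc_rational_diff: "nc_rational f \<Longrightarrow> nc_rational g \<Longrightarrow> nc_rational (f - g)"
  using nc_rational.add [of f "- g"] by (simp add: nc_rational_uminus)

lemma nc_rational_sum: "(\<And>i. i \<in> I \<Longrightarrow> nc_rational (f i)) \<Longrightarrow> nc_rational (sum f I)"
  by (induction I rule: infinite_finite_induct) (auto intro: nc_rational_0 nc_rational.add)

text \<open>Induction on the set of unknowns: row \<open>k\<close> is solved for \<open>X k\<close>
  by inverting \<open>1 - A k k\<close>, and the result is substituted into the other rows.\<close>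

lemma nc_rational_linear_system:
  fixes X :: "'i \<Rightarrow> ('x, 'c::field) nc_fps"
  assumes "finite I"
    and "\<And>i. i \<in> I \<Longrightarrow> nc_rational (C i)"
    and "\<And>i j. i \<in> I \<Longrightarrow> j \<in> I \<Longrightarrow> nc_rational (A i j) \<and> nc_nth (A i j) [] = 0"
    and "\<And>i. i \<in> I \<Longrightarrow> X i = C i + (\<Sum>j\<in>I. A i j * X j)"
    and "i \<in> I"
  shows "nc_rational (X i)"
  using assms
proof (induction I arbitrary: A C i rule: finite_induct)
  case (insert k I)
  note C = insert.prems(1) and A = insert.prems(2) and eq = insert.prems(3)
  obtain g where g: "(1 - A k k) * g = 1" "g * (1 - A k k) = 1"
    using nc_geometric_inverse [of "A k k"] A by auto
  have g_rat: "nc_rational g"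
    by (rule nc_rational.inverse [OF _ _ g]) (use A in \<open>auto intro: nc_rational_diff nc_rational_1\<close>)
  have "(1 - A k k) * X k = C k + (\<Sum>j\<in>I. A k j * X j)"
    using eq [of k] insert.hyps by (simp add: algebra_simps)
  then have "g * (1 - A k k) * X k = g * (C k + (\<Sum>j\<in>I. A k j * X j))"
    by (simp only: mult.assoc)
  then have Xk: "X k = g * (C k + (\<Sum>j\<in>I. A k j * X j))"
    by (simp add: g)
  have rat: "nc_rational (X i)" if "i \<in> I" for i
  \<comment> \<open>Substituting \<open>X k\<close> yields these data. The new coefficients again
    have constant term zero, since \<open>A i j\<close> and \<open>A i k\<close> do.\<close>
  proof (rule insert.IH [where C = "\<lambda>i. C i + A i k * g * C k"
        and A = "\<lambda>i j. A i j + A i k * g * A k j"])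
    show "nc_rational (C i + A i k * g * C k)" if "i \<in> I" for i
      using that A C g_rat by (blast intro: nc_rational.add nc_rational.mult)
    show "nc_rational (A i j + A i k * g * A k j) \<and> nc_nth (A i j + A i k * g * A k j) [] = 0"
      if "i \<in> I" "j \<in> I" for i j
      using that A g_rat by (auto intro!: nc_rational.add nc_rational.mult)
    show "X i = C i + A i k * g * C k + (\<Sum>j\<in>I. (A i j + A i k * g * A k j) * X j)"
      if "i \<in> I" for i
    proof -
      have "X i = C i + A i k * X k + (\<Sum>j\<in>I. A i j * X j)"
        using eq [of i] that insert.hyps by (simp add: algebra_simps)
      also have "A i k * X k = A i k * g * C k + (\<Sum>j\<in>I. A i k * g * A k j * X j)"
        by (subst Xk) (simp add: algebra_simps sum_distrib_left)
      finally show ?thesis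
        by (simp add: algebra_simps sum.distrib)
    qed
  qed (rule that)
  have "nc_rational (X k)"
    by (subst Xk) (use A C rat g_rat in \<open>auto intro!: nc_rational.mult nc_rational.add nc_rational_sum\<close>)
  with rat insert.prems(4) show ?case
    by blast
qed simp

section \<open>Formal sums of homogeneous series\<close>

lemma nc_homogeneous_nth_eq_0: "nc_homogeneous n f \<Longrightarrow> length w \<noteq> n \<Longrightarrow> nc_nth f w = 0"
  by (auto simp: nc_homogeneous_def)

text \<open>As \<open>f\<close> is supported on words of length one, only the split after the first
  letter contributes.\<close>

lemma nc_nth_homogeneous_mult_Cons:
  assumes "nc_homogeneous 1 f"
  shows "nc_nth (f * g) (a # w) = nc_nth f [a] * nc_nth g w"
proof -
  have "(\<lambda>u. nc_nth f (a # u)) = (\<lambda>u. nc_nth f [a] * (if u = [] then 1 else 0))"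
    by (auto simp: fun_eq_iff nc_homogeneous_nth_eq_0 [OF assms])
  moreover have "nc_nth f [] = 0"
    by (simp add: nc_homogeneous_nth_eq_0 [OF assms])
  ultimately show ?thesis
    by (simp only: times_nc_fps.rep_eq word_conv_Cons word_conv_scale_left word_conv_one_left) simp
qed

lemma nc_nth_formal_sum:
  assumes "\<And>m. nc_homogeneous m (F m)"
  shows "nc_nth (nc_formal_sum F) w = nc_nth (F (length w)) w"
proof -
  have "nc_nth (F m) w = 0" if "m \<noteq> length w" for m
    using nc_homogeneous_nth_eq_0 [OF assms] that by metis
  then have "{m. nc_nth (F m) w \<noteq> 0} = (if nc_nth (F (length w)) w = 0 then {} else {length w})"
    by auto metis
  then show ?thesis
    by (simp add: nc_formal_sum_def Abs_nc_fps_inverse)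
qed

section \<open>Chains of the level poset\<close>

text \<open>This is the Boolean matrix power acting on vertex sets. There are finitely many such
  sets, hence finitely many unknowns.\<close>

definition reach :: "nat ^ 'v ^ 'v \<Rightarrow> 'v::finite set \<Rightarrow> nat \<Rightarrow> 'v set" where
  "reach M S n = {v. \<exists>u\<in>S. matrix_power M n $ u $ v > 0}"

lemma reach_add: "reach M S (m + n) = reach M (reach M S m) n"
  by (auto simp: reach_def matrix_power_add_pos_iff)

lemma level_less_iff_reach:
  "level_less M (x, k) (z, k + int i + 1) \<longleftrightarrow> z \<in> reach M {x} (Suc i)"
  by (simp add: level_less_def reach_def nat_add_distrib flip: of_nat_Suc)

text \<open>No carrier is mentioned, so removing the bottom of a chain with further elements leaves
  a chain of the same kind with a new bottom.\<close>

definition level_chains :: "nat ^ 'v ^ 'v \<Rightarrow> 'v::finite \<times> int \<Rightarrow> 'v \<times> int \<Rightarrow> ('v \<times> int) list set"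
  where "level_chains M p q =
    {c. c \<noteq> [] \<and> sorted_wrt (level_less M) c \<and> hd c = p \<and> last c = q}"

lemma level_less_trans: "level_less M p q \<Longrightarrow> level_less M q r \<Longrightarrow> level_less M p r"
proof -
  interpret ordering "level_le M" "level_less M"
    by (rule level_ordering)
  show "level_less M p q \<Longrightarrow> level_less M q r \<Longrightarrow> level_less M p r"
    by (rule strict_trans)
qed

lemma level_chains_subset_interval:
  assumes "c \<in> level_chains M p q"
  shows "set c \<subseteq> level_interval M p q"
proof
  fix z assume "z \<in> set c"
  then obtain us vs where c: "c = us @ z # vs"
    by (auto dest: split_list)
  have "level_le M p z"
    using assms unfolding c by (cases us) (auto simp: level_chains_def level_le_def)
  moreover have "level_le M z q"
    using assms unfolding c
    by (cases vs rule: rev_cases) (auto simp: level_chains_def level_le_def sorted_wrt_append)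
  ultimately show "z \<in> level_interval M p q"
    by (simp add: level_interval_def)
qed

lemma bounded_chains_level_interval:
  "bounded_chains (level_interval M p q) (level_less M) p q = level_chains M p q"
proof -
  have "bounded_chains (level_interval M p q) (level_less M) p q =
      {c \<in> level_chains M p q. set c \<subseteq> level_interval M p q}"
    by (auto simp: bounded_chains_def level_chains_def)
  then show ?thesis
    using level_chains_subset_interval by blast
qed

lemma level_chains_le: "c \<in> level_chains M p q \<Longrightarrow> level_le M p q"
proof -
  assume c: "c \<in> level_chains M p q"
  then have "q \<in> set c"
    by (auto simp: level_chains_def)
  with level_chains_subset_interval [OF c] show ?thesis
    by (auto simp: level_interval_def)
qed

lemma level_ab_index_eq: "level_ab_index M p q = (\<Sum>c\<in>level_chains M p q. wt snd c)"
proof (cases "level_le M p q")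
  case False
  then have "level_chains M p q = {}"
    using level_chains_le by blast
  then show ?thesis
    using False by (simp add: level_ab_index_def)
qed (simp add: level_ab_index_def ab_index_def bounded_chains_level_interval)

lemma finite_level_chains: "finite (level_chains M p q)"
  unfolding bounded_chains_level_interval [symmetric]
  by (rule finite_bounded_chains) (auto simp: finite_level_interval level_less_def)

text \<open>The second element is either \<open>q\<close> or of smaller rank than \<open>q\<close>.
  The rank bound keeps the index set finite and separates the two cases.\<close>

lemma level_chains_Cons:
  assumes "p \<noteq> q"
  shows "level_chains M p q =
    (if level_less M p q then {[p, q]} else {}) \<union>
    (\<Union>r\<in>{r. level_less M p r \<and> snd r < snd q}. (#) p ` level_chains M r q)" (is "?L = ?R")
proof (intro equalityI subsetI)
  fix c assume "c \<in> ?L"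
  then obtain c' where "c = p # c'" "c' \<noteq> []"
    using assms by (cases c) (auto simp: level_chains_def split: if_splits)
  then obtain r d where "c = p # r # d"
    by (cases c') auto
  with \<open>c \<in> ?L\<close> have c: "c = p # r # d" "level_less M p r" "r # d \<in> level_chains M r q"
    by (simp_all add: level_chains_def)
  show "c \<in> ?R"
  proof (cases "d = []")
    case True
    then show ?thesis
      using c by (auto simp: level_chains_def)
  next
    case False
    then have "last d \<in> set d"
      by simp
    with c(3) False have "level_less M r q"
      by (auto simp: level_chains_def)
    then have "snd r < snd q"
      by (simp add: level_less_def)
    then show ?thesis
      using c by blast
  qed
next
  fix c assume "c \<in> ?R"
  then consider "level_less M p q" "c = [p, q]"
    | r d where "level_less M p r" "c = p # d" "d \<in> level_chains M r q"
    by (auto split: if_splits)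
  then show "c \<in> ?L"
  proof cases
    case 2
    then obtain e where d: "d = r # e"
      by (cases d) (simp_all add: level_chains_def)
    with 2(3) have "level_less M r z" if "z \<in> set e" for z
      using that by (simp add: level_chains_def)
    then have "level_less M p z" if "z \<in> set d" for z
      using that d 2(1) level_less_trans by (metis set_ConsD)
    with 2 show ?thesis
      by (simp add: level_chains_def d)
  qed (simp add: level_chains_def)
qed

lemma finite_level_less_below: "finite {r. level_less M p r \<and> snd r < k}"
  by (rule finite_subset [of _ "UNIV \<times> {snd p..k}"]) (auto simp: level_less_def)

section \<open>Recursion on the second element of a chain\<close>

abbreviation var_t :: ab_series where "var_t \<equiv> var_a - var_b"

text \<open>Since \<open>r \<noteq> q\<close>, the list \<open>d\<close> has at least two elements,
  so the first equation of \<open>wt\<close> applies to \<open>p # d\<close>.\<close>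

lemma wt_Cons_level_chain:
  assumes "d \<in> level_chains M r q" "r \<noteq> q"
  shows "wt snd (p # d) = var_t ^ nat (snd r - snd p - 1) * var_b * wt snd d"
  using assms by (cases d; cases "tl d") (auto simp: level_chains_def)

lemma level_ab_index_step:
  assumes "snd p < snd q"
  shows "level_ab_index M p q =
    (if level_less M p q then var_t ^ nat (snd q - snd p - 1) else 0) +
    (\<Sum>r | level_less M p r \<and> snd r < snd q.
       var_t ^ nat (snd r - snd p - 1) * var_b * level_ab_index M r q)"
proof -
  let ?R = "{r. level_less M p r \<and> snd r < snd q}"
  let ?U = "\<Union>r\<in>?R. (#) p ` level_chains M r q"
  have "p \<noteq> q"
    using assms by auto
  have finU: "finite ?U"
    using finite_level_less_below finite_level_chains by blast
  \<comment> \<open>Membership would put \<open>[q]\<close> into \<open>level_chains M r q\<close>,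
    forcing \<open>r = q\<close> against the rank bound.\<close>
  have notU: "[p, q] \<notin> ?U"
    by (auto simp: level_chains_def)
  \<comment> \<open>The pieces are disjoint because the second element of a chain determines
    \<open>r\<close>.\<close>
  have "(\<Sum>c\<in>?U. wt snd c) = (\<Sum>r\<in>?R. \<Sum>c\<in>(#) p ` level_chains M r q. wt snd c)"
    by (rule sum.UNION_disjoint)
      (auto simp: finite_level_less_below finite_level_chains, auto simp: level_chains_def)
  also have "\<dots> = (\<Sum>r\<in>?R. var_t ^ nat (snd r - snd p - 1) * var_b * level_ab_index M r q)"
  proof (rule sum.cong [OF refl])
    fix r assume "r \<in> ?R"
    then have "r \<noteq> q"
      by auto
    have "(\<Sum>c\<in>(#) p ` level_chains M r q. wt snd c) = (\<Sum>d\<in>level_chains M r q. wt snd (p # d))"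
      by (subst sum.reindex) auto
    also have "\<dots> = (\<Sum>d\<in>level_chains M r q.
        var_t ^ nat (snd r - snd p - 1) * var_b * wt snd d)"
      using \<open>r \<noteq> q\<close> by (intro sum.cong refl wt_Cons_level_chain)
    finally show "(\<Sum>c\<in>(#) p ` level_chains M r q. wt snd c) =
        var_t ^ nat (snd r - snd p - 1) * var_b * level_ab_index M r q"
      by (simp add: level_ab_index_eq sum_distrib_left)
  qed
  finally show ?thesis
    using finU notU by (simp add: level_ab_index_eq level_chains_Cons [OF \<open>p \<noteq> q\<close>])
qed

text \<open>Writing the second element as \<open>(z, k + int i + 1)\<close> turns the exponent of
  \<open>var_t\<close> into \<open>i\<close> and sorts the sum by level.\<close>

lemma level_ab_index_rec:
  "level_ab_index M (x, k) (y, k + int n + 1) =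
    (if y \<in> reach M {x} (Suc n) then var_t ^ n else 0) +
    (\<Sum>i<n. \<Sum>z\<in>reach M {x} (Suc i).
       var_t ^ i * var_b * level_ab_index M (z, k + int i + 1) (y, k + int n + 1))"
proof -
  let ?f = "\<lambda>i z. var_t ^ i * var_b * level_ab_index M (z, k + int i + 1) (y, k + int n + 1)"
  have "(\<Sum>i<n. \<Sum>z\<in>reach M {x} (Suc i). ?f i z) =
      (\<Sum>(i, z)\<in>(SIGMA i:{..<n}. reach M {x} (Suc i)). ?f i z)"
    by (rule sum.Sigma) auto
  also have "\<dots> = (\<Sum>r | level_less M (x, k) r \<and> snd r < k + int n + 1.
      var_t ^ nat (snd r - k - 1) * var_b * level_ab_index M r (y, k + int n + 1))"
  proof (rule sum.reindex_bij_witness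
      [of _ "\<lambda>r. (nat (snd r - k - 1), fst r)" "\<lambda>(i, z). (z, k + int i + 1)"])
    fix r assume r: "r \<in> {r. level_less M (x, k) r \<and> snd r < k + int n + 1}"
    then have "snd r > k"
      by (auto simp: level_less_def)
    then have "snd r = k + int (nat (snd r - k - 1)) + 1"
      by simp
    then obtain i z where "r = (z, k + int i + 1)"
      by (metis prod.collapse)
    with r show "(nat (snd r - k - 1), fst r) \<in> (SIGMA i:{..<n}. reach M {x} (Suc i))"
      by (auto simp: level_less_iff_reach)
    show "(case (nat (snd r - k - 1), fst r) of (i, z) \<Rightarrow> (z, k + int i + 1)) = r"
      using \<open>snd r > k\<close> by (auto simp: prod_eq_iff)
  qed (auto simp: level_less_iff_reach)
  finally show ?thesis
    by (simp add: level_ab_index_step level_less_iff_reach)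
qed

text \<open>The recursion sees levels only through their differences, and the intervals on its right
  side are shorter.\<close>

lemma level_ab_index_shift:
  "level_ab_index M (x, k) (y, k + int n + 1) = level_ab_index M (x, 0) (y, int n + 1)"
proof (induction n arbitrary: x k rule: less_induct)
  case (less n)
  have "level_ab_index M (z, l + int i + 1) (y, l + int n + 1) =
      level_ab_index M (z, 0) (y, int (n - Suc i) + 1)" if "i < n" for z l i
  proof -
    have "l + int n + 1 = (l + int i + 1) + int (n - Suc i) + 1"
      using that by simp
    then show ?thesis
      using less [of "n - Suc i" z "l + int i + 1"] that by (simp only:)
  qed
  from this [where l = k] this [where l = 0] show ?case
    using level_ab_index_rec [of M x k y n] level_ab_index_rec [of M x 0 y n] by simp
qed

text \<open>
  The degree \<open>n\<close> part of the unknown \<open>X S\<close>: chains from the set \<open>S\<close> at level \<open>0\<close> to \<open>(y, n + 1)\<close>.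
\<close>

definition set_ab_index :: "nat ^ 'v ^ 'v \<Rightarrow> 'v \<Rightarrow> 'v::finite set \<Rightarrow> nat \<Rightarrow> ab_series" where
  "set_ab_index M y S n =
    (if y \<in> reach M S (Suc n) then var_t ^ n else 0) +
    (\<Sum>i<n. \<Sum>z\<in>reach M S (Suc i).
       var_t ^ i * var_b * level_ab_index M (z, 0) (y, int (n - Suc i) + 1))"

lemma set_ab_index_singleton: "set_ab_index M y {x} n = level_ab_index M (x, 0) (y, int n + 1)"
proof -
  have "level_ab_index M (z, int i + 1) (y, int n + 1) =
      level_ab_index M (z, 0) (y, int (n - Suc i) + 1)" if "i < n" for z i
    using level_ab_index_shift [of M z "int i + 1" y "n - Suc i"] that by (simp add: of_nat_diff)
  then show ?thesis
    using level_ab_index_rec [of M x 0 y n] by (simp add: set_ab_index_def)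
qed

lemma set_ab_index_0: "set_ab_index M y S 0 = (if y \<in> reach M S 1 then 1 else 0)"
  by (simp add: set_ab_index_def)

text \<open>The summands with \<open>i = 0\<close> give the terms with \<open>var_b\<close>. All
  others carry a factor \<open>var_t\<close> and reassemble, by \<open>reach_add\<close>, into the
  expression for \<open>reach M S 1\<close>.\<close>

lemma set_ab_index_Suc:
  "set_ab_index M y S (Suc n) =
    var_t * set_ab_index M y (reach M S 1) n +
    (\<Sum>z\<in>reach M S 1. var_b * set_ab_index M y {z} n)"
proof -
  have reach_Suc: "reach M S (Suc m) = reach M (reach M S 1) m" for m
    using reach_add [of M S 1 m] by simp
  show ?thesis
    \<comment> \<open>Rewriting singletons first protects them: the next unfolding then expands only
      the expressions for \<open>S\<close> and \<open>reach M S 1\<close>.\<close>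
    unfolding set_ab_index_singleton
    unfolding set_ab_index_def
    by (simp add: sum.lessThan_Suc_shift reach_Suc [of "Suc _"] distrib_left sum_distrib_left
        mult.assoc add_ac del: sum.lessThan_Suc)
qed

lemma nc_homogeneous_set_ab_index: "nc_homogeneous n (set_ab_index M y S n)"
proof -
  have "nc_homogeneous n (var_t ^ i * var_b * level_ab_index M (z, 0) (y, int (n - Suc i) + 1))"
    (is "nc_homogeneous n ?f") if "i < n" for i z
  proof -
    \<comment> \<open>The three degrees add up to \<open>n\<close> because
      \<open>i < n\<close>.\<close>
    have "nc_homogeneous (i + 1 + (n - Suc i)) ?f"
      by (intro nc_homogeneous_mult nc_homogeneous_power ab_homogeneous level_ab_index_homogeneous)
    then show ?thesis
      using that by simp
  qed
  then show ?thesis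
    unfolding set_ab_index_def
    by (auto intro!: nc_homogeneous_add nc_homogeneous_sum nc_homogeneous_zero
        nc_homogeneous_power ab_homogeneous)
qed

section \<open>The finite linear system for the set-indexed series\<close>

definition set_ab_series :: "nat ^ 'v ^ 'v \<Rightarrow> 'v \<Rightarrow> 'v::finite set \<Rightarrow> ab_series" where
  "set_ab_series M y S = nc_formal_sum (set_ab_index M y S)"

lemma set_ab_series_eq:
  "set_ab_series M y S =
    (if y \<in> reach M S 1 then 1 else 0) + var_t * set_ab_series M y (reach M S 1) +
    (\<Sum>z\<in>reach M S 1. var_b * set_ab_series M y {z})"
proof (rule nc_fps_eqI)
  fix w
  have nth: "nc_nth (set_ab_series M y T) v = nc_nth (set_ab_index M y T (length v)) v" for T v
    unfolding set_ab_series_def by (intro nc_nth_formal_sum nc_homogeneous_set_ab_index)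
  have var_Nil: "nc_nth var_t [] = 0" "nc_nth var_b [] = 0"
    by (simp_all add: var_a_def var_b_def nc_var.rep_eq)
  show "nc_nth (set_ab_series M y S) w = nc_nth
    ((if y \<in> reach M S 1 then 1 else 0) + var_t * set_ab_series M y (reach M S 1) +
    (\<Sum>z\<in>reach M S 1. var_b * set_ab_series M y {z})) w"
  \<comment> \<open>The empty word sees only the indicator; on other words, stripping the first
    letter leads to the recursion in \<open>n\<close>. Deleting \<open>nc_nth_simps(4)\<close> keeps
    \<open>var_t\<close> whole as a series of degree one.\<close>
  proof (cases w)
    case Nil
    then show ?thesis
      by (simp add: nth set_ab_index_0 var_Nil del: nc_nth_simps(4))
  next
    case (Cons a v)
    then show ?thesis
      by (simp add: nth set_ab_index_Suc ab_homogeneous [THEN nc_nth_homogeneous_mult_Cons]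
          del: nc_nth_simps(4))
  qed
qed

lemma nc_rational_set_ab_series: "nc_rational (set_ab_series M y S)"
proof -
  let ?C = "\<lambda>S. if y \<in> reach M S 1 then 1 else 0 :: ab_series"
  \<comment> \<open>A sum of indicators is used because \<open>reach M S 1\<close> may itself be a
    singleton \<open>{z}\<close>, whose unknown then gets both \<open>var_t\<close> and
    \<open>var_b\<close>.\<close>
  let ?A = "\<lambda>S T. (if T = reach M S 1 then var_t else 0) +
    (\<Sum>z\<in>reach M S 1. if T = {z} then var_b else 0)"
  have C: "nc_rational (?C S)" for S
    by (simp add: nc_rational_0 nc_rational_1)
  have A: "nc_rational (?A S T) \<and> nc_nth (?A S T) [] = 0" for S T
  proof
    show "nc_rational (?A S T)"
      by (intro nc_rational.add nc_rational_sum)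
        (simp_all add: var_a_def var_b_def nc_rational_0 nc_rational_diff nc_rational_var)
    show "nc_nth (?A S T) [] = 0"
      by (simp add: var_a_def var_b_def nc_var.rep_eq sum.neutral)
  qed
  have eq: "set_ab_series M y S = ?C S + (\<Sum>T\<in>UNIV. ?A S T * set_ab_series M y T)" for S
  proof -
    have "(\<Sum>T\<in>UNIV. ?A S T * set_ab_series M y T) =
        (\<Sum>T\<in>UNIV. if T = reach M S 1 then var_t * set_ab_series M y T else 0) +
        (\<Sum>T\<in>UNIV. \<Sum>z\<in>reach M S 1. if T = {z} then var_b * set_ab_series M y T else 0)"
      unfolding sum.distrib [symmetric]
      by (intro sum.cong refl)
        (simp add: distrib_right sum_distrib_right if_distrib [where f = "\<lambda>f. f * g" for g]
          cong: if_cong)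
    also have "(\<Sum>T\<in>UNIV. \<Sum>z\<in>reach M S 1. if T = {z} then var_b * set_ab_series M y T else 0) =
        (\<Sum>z\<in>reach M S 1. var_b * set_ab_series M y {z})"
      by (subst sum.swap) simp
    finally show ?thesis
      by (subst set_ab_series_eq) (simp add: add.assoc)
  qed
  show ?thesis
    by (rule nc_rational_linear_system [where I = UNIV, OF _ C A eq]) simp_all
qed

theorem theorem7p3:
  fixes M :: "nat ^ 'v::finite ^ 'v" and x y :: 'v
  assumes "zero_one_matrix M"
  shows "nc_rational (level_ab_series M x y)"
proof -
  have "level_ab_series M x y = set_ab_series M y {x}"
    by (simp add: level_ab_series_def set_ab_series_def flip: set_ab_index_singleton)
  then show ?thesis
    by (simp add: nc_rational_set_ab_series)
qed

end
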